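(* Let $M\in\mathbb N$, $\mathcal F=\mathbb N_0^M$, and let $(u_n)_{n\in\mathbb N_0}$ be the approximations of $u:\boldsymbol\Gamma\to\mathcal H$ constructed by the generic adaptive algorithm described in the context, with index sets $\Lambda_n$, candidate sets $\mathcal C_n$, marked sets $\mathcal M_n$ and non-negative error estimates $\eta_n(\mathbf k)=\eta(\mathbf k,u_n)$. Let $\|\cdot\|$ be a norm for functions $v:\boldsymbol\Gamma\to\mathcal H$. Assume that 1. the total error estimator $\eta_n:=\sum_{\mathbf k\in\mathcal C_n}\eta_n(\mathbf k)$ is reliable, i.e., there is a constant $C<\infty$ independent of $n$ with $\|u-u_n\|\le C\eta_n$ for all $n$; 2. there is a sequence of non-negative numbers $(\eta_\infty(\mathbf k))_{\mathbf k\in\mathcal F}\in\ell^1(\mathcal F)$ such that, with $\widehat\eta_n(\mathbf k):=\eta_n(\mathbf k)$ for $\mathbf k\in\mathcal C_n\cup\Lambda_n$ and $\widehat\eta_n(\mathbf k):=0$ otherwise, $$\lim_{n\to\infty}\|\eta_\infty-\widehat\eta_n\|_{\ell^1}=0;$$ 3. there is a constant $c>0$ independent of $n$ such that for all $n$ and all $\mathbf k\in\mathcal C_n\setminus\mathcal M_n$ $$\eta_n(\mathbf k)\le c\sum_{\mathbf i\in\mathcal M_n}\eta_n(\mathbf i).$$ Then $\lim_{n\to\infty}\|u-u_n\|=0$.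
   Context: $\boldsymbol\Gamma=[-1,1]^M$, $\mathcal H$ is a Hilbert space, and $u:\boldsymbol\Gamma\to\mathcal H$ is the function to be approximated. For every finite $\Lambda\subset\mathcal F$ an approximation $S_\Lambda u:\boldsymbol\Gamma\to\mathcal H$ of $u$ is given ($S_\Lambda$ is an arbitrary approximation operator; no further property of it is assumed). For each $\mathbf k\in\mathcal F$ and each approximation $u_n$, $\eta(\mathbf k,u_n)\ge0$ is a given non-negative number (an estimate of the error contribution of $\mathbf k$). **Generic adaptive algorithm.** $\Lambda_0=\{\mathbf 0\}$, $u_0=S_{\Lambda_0}u$. For $n=0,1,2,\dots$: choose a candidate set $\mathcal C_n\subset\mathcal F\setminus\Lambda_n$; evaluate $\eta_n(\mathbf k)=\eta(\mathbf k,u_n)$ for $\mathbf k\in\mathcal C_n$; determine a finite set of marked indices $\mathcal M_n\subset\mathcal C_n$ by some marking strategy; set $\Lambda_{n+1}=\Lambda_n\cup\mathcal M_n$ and $u_{n+1}=S_{\Lambda_{n+1}}u$. *)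

theory Defs
  imports "HOL-Analysis.Analysis"
begin

definition param_cube :: "(real ^ 'm) set" where
  "param_cube = {x. \<forall>i. - 1 \<le> x $ i \<and> x $ i \<le> 1}"

(* N is a norm on the linear space V of functions on space \<mu>; its values outside V are irrelevant.
   Functions that agree \<mu>-almost everywhere are identified, as for Bochner spaces L^p(\<mu>).
   For \<mu> = count_space \<Gamma> this is identification of functions that agree at every point of \<Gamma>
   (AE_count_space), so N is then a norm on functions \<Gamma> \<Rightarrow> 'h in the pointwise sense. *)
definition function_norm ::
  "'a measure \<Rightarrow> ('a \<Rightarrow> 'h::real_vector) set \<Rightarrow> (('a \<Rightarrow> 'h) \<Rightarrow> real) \<Rightarrow> bool" where
  "function_norm \<mu> V N \<longleftrightarrow>
     (\<lambda>x. 0) \<in> V \<and>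
     (\<forall>v\<in>V. \<forall>w\<in>V. (\<lambda>x. v x + w x) \<in> V) \<and>
     (\<forall>a. \<forall>v\<in>V. (\<lambda>x. a *\<^sub>R v x) \<in> V) \<and>
     (\<forall>v\<in>V. 0 \<le> N v) \<and>
     (\<forall>v\<in>V. N v = 0 \<longleftrightarrow> (AE x in \<mu>. v x = 0)) \<and>
     (\<forall>a. \<forall>v\<in>V. N (\<lambda>x. a *\<^sub>R v x) = \<bar>a\<bar> * N v) \<and>
     (\<forall>v\<in>V. \<forall>w\<in>V. N (\<lambda>x. v x + w x) \<le> N v + N w)"

(* The sequences \<Lambda>, U, C, M arise from a run of the generic adaptive algorithm for u with the
   approximation operators S. Both the choice of C n and the marking strategy are arbitrary; only
   M n has to be finite. *)
definition adaptive_run ::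
  "((nat ^ 'm) set \<Rightarrow> (real ^ 'm \<Rightarrow> 'h) \<Rightarrow> (real ^ 'm \<Rightarrow> 'h)) \<Rightarrow> (real ^ 'm \<Rightarrow> 'h) \<Rightarrow>
   (nat \<Rightarrow> (nat ^ 'm) set) \<Rightarrow> (nat \<Rightarrow> (real ^ 'm \<Rightarrow> 'h)) \<Rightarrow>
   (nat \<Rightarrow> (nat ^ 'm) set) \<Rightarrow> (nat \<Rightarrow> (nat ^ 'm) set) \<Rightarrow> bool" where
  "adaptive_run S u \<Lambda> U C M \<longleftrightarrow>
     \<Lambda> 0 = {0} \<and>
     (\<forall>n. U n = S (\<Lambda> n) u) \<and>
     (\<forall>n. C n \<subseteq> - \<Lambda> n) \<and>
     (\<forall>n. M n \<subseteq> C n \<and> finite (M n)) \<and>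
     (\<forall>n. \<Lambda> (Suc n) = \<Lambda> n \<union> M n)"

(* Sums over index sets that may be infinite are taken in ennreal, where infsum is the true
   (possibly infinite) sum; over the reals infsum is 0 for divergent series. *)
definition total_estimator ::
  "('k \<Rightarrow> 'v \<Rightarrow> real) \<Rightarrow> 'v \<Rightarrow> 'k set \<Rightarrow> ennreal" where
  "total_estimator \<eta> v C = (\<Sum>\<^sub>\<infinity>k\<in>C. ennreal (\<eta> k v))"

definition l1_norm :: "('k \<Rightarrow> real) \<Rightarrow> ennreal" where
  "l1_norm f = (\<Sum>\<^sub>\<infinity>k\<in>UNIV. ennreal \<bar>f k\<bar>)"

definition extended_estimator ::
  "('k \<Rightarrow> 'v \<Rightarrow> real) \<Rightarrow> 'v \<Rightarrow> 'k set \<Rightarrow> 'k \<Rightarrow> real" where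
  "extended_estimator \<eta> v A k = (if k \<in> A then \<eta> k v else 0)"

end

theory Submission
  imports Defs
begin

text \<open>
  By disjointness, every index is marked at most once. Dominated convergence with majorant
  \<open>\<eta>\<^sub>\<infinity>\<close> gives that the sum of \<open>\<eta>\<^sub>\<infinity>\<close> over the marked set tends to 0, and so does the sum of
  \<open>\<eta>\<^sub>n\<close>, as the two differ by at most the \<open>\<ell>\<^sup>1\<close> error. The marking condition then bounds \<open>\<eta>\<^sub>n\<close>, and up
  to the \<open>\<ell>\<^sup>1\<close> error also \<open>\<eta>\<^sub>\<infinity>\<close>, uniformly on the candidate set by a null sequence. A second
  application of dominated convergence shows that the sum of \<open>\<eta>\<^sub>\<infinity>\<close> over the candidate sets tends to
  0, hence so does the total error estimator.
\<close>

lemma infsum_ennreal_add: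
  fixes f g :: "'k \<Rightarrow> ennreal"
  shows "infsum (\<lambda>k. f k + g k) A = infsum f A + infsum g A"
  by (intro infsum_add nonneg_summable_on_complete) auto

lemma infsum_ennreal_mono:
  fixes f g :: "'k \<Rightarrow> ennreal"
  assumes "A \<subseteq> B" "\<And>k. k \<in> A \<Longrightarrow> f k \<le> g k"
  shows "infsum f A \<le> infsum g B"
  using assms by (intro infsum_mono_neutral nonneg_summable_on_complete) auto

lemma member_le_infsum_ennreal:
  fixes f :: "'k \<Rightarrow> ennreal"
  assumes "k \<in> A"
  shows "f k \<le> infsum f A"
  using infsum_ennreal_mono[of "{k}" A f f] assms by simp

lemma ennreal_tendsto_0_le:
  fixes f g :: "'k \<Rightarrow> ennreal"
  assumes "(g \<longlongrightarrow> 0) F" "\<And>n. f n \<le> g n"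
  shows "(f \<longlongrightarrow> 0) F"
  using assms by (intro tendsto_sandwich[OF _ _ tendsto_const assms(1)]) auto

text \<open>Dominated convergence for the counting measure: outside a large finite set the majorant
  \<open>a\<close> has a small sum, and on that set finitely many null sequences are added.\<close>

lemma infsum_dominated_tendsto_0:
  fixes f :: "nat \<Rightarrow> 'k \<Rightarrow> ennreal"
  assumes fin: "infsum a UNIV < \<infinity>"
    and bound: "\<And>n k. f n k \<le> a k"
    and lim: "\<And>k. (\<lambda>n. f n k) \<longlonglongrightarrow> 0"
  shows "(\<lambda>n. infsum (f n) UNIV) \<longlonglongrightarrow> 0"
proof (rule order_tendstoI)
  fix e :: ennreal
  assume "0 < e"
  then obtain d where d: "0 < d" "d < e"
    using dense by blast
  have "\<exists>F. finite F \<and> infsum a (- F) \<le> d"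
  proof (cases "infsum a UNIV = 0")
    case True
    then show ?thesis by (intro exI[of _ "{}"]) simp
  next
    case False
    \<comment> \<open>Subtraction in \<open>ennreal\<close> truncates at 0, so strictness needs a
      positive total; hence the case split.\<close>
    then have "infsum a UNIV - d < infsum a UNIV"
      using d fin by (intro ennreal_between) (auto simp: zero_less_iff_neq_zero)
    then obtain F where F: "finite F" "infsum a UNIV - d < sum a F"
      by (auto simp: nonneg_infsum_complete less_SUP_iff)
    have split: "infsum a UNIV = sum a F + infsum a (- F)"
      using infsum_Un_disjoint[of a F "- F"] F by (simp add: nonneg_summable_on_complete)
    have "sum a F + infsum a (- F) \<le> sum a F + d"
      unfolding split[symmetric] using less_imp_le[OF F(2)]
      by (simp add: ennreal_minus_le_iff add.commute)
    \<comment> \<open>Cancelling a summand in \<open>ennreal\<close> is sound only if it is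
      finite.\<close>
    moreover have "sum a F < \<infinity>"
      using fin split by simp
    ultimately show ?thesis
      using F(1) by (auto simp: ennreal_add_left_cancel_le)
  qed
  then obtain F where F: "finite F" "infsum a (- F) \<le> d"
    by blast
  have "(\<lambda>n. sum (f n) F + d) \<longlonglongrightarrow> (\<Sum>k\<in>F. 0) + d"
    by (intro tendsto_add tendsto_sum lim tendsto_const)
  then have ev: "\<forall>\<^sub>F n in sequentially. sum (f n) F + d < e"
    using d(2) by (intro order_tendstoD) auto
  have bound_n: "infsum (f n) UNIV \<le> sum (f n) F + d" for n
  proof -
    have "infsum (f n) UNIV = sum (f n) F + infsum (f n) (- F)"
      using infsum_Un_disjoint[of "f n" F "- F"] F(1) by (simp add: nonneg_summable_on_complete)
    moreover have "infsum (f n) (- F) \<le> d"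
      by (rule order_trans[OF infsum_ennreal_mono F(2)]) (auto simp: bound)
    ultimately show ?thesis by (simp add: add_left_mono)
  qed
  show "\<forall>\<^sub>F n in sequentially. infsum (f n) UNIV < e"
    using ev by (rule eventually_mono) (rule le_less_trans[OF bound_n])
qed auto

lemma infsum_subset_tendsto_0:
  fixes a :: "'k \<Rightarrow> ennreal"
  assumes fin: "infsum a UNIV < \<infinity>"
    and lim: "\<And>k. (\<lambda>n. if k \<in> A n then a k else 0) \<longlonglongrightarrow> 0"
  shows "(\<lambda>n. infsum a (A n)) \<longlonglongrightarrow> 0"
proof -
  have "infsum a (A n) = infsum (\<lambda>k. if k \<in> A n then a k else 0) UNIV" for n
    by (intro infsum_cong_neutral) auto
  then show ?thesis
    using infsum_dominated_tendsto_0[OF fin, of "\<lambda>n k. if k \<in> A n then a k else 0"] lim by simp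
qed

text \<open>Each index lies in at most one \<open>A n\<close>, so its contribution vanishes from
  some \<open>n\<close> on.\<close>

lemma infsum_disjoint_family_tendsto_0:
  fixes a :: "'k \<Rightarrow> ennreal"
  assumes fin: "infsum a UNIV < \<infinity>" and disj: "disjoint_family A"
  shows "(\<lambda>n. infsum a (A n)) \<longlonglongrightarrow> 0"
proof (rule infsum_subset_tendsto_0[OF fin])
  fix k
  show "(\<lambda>n. if k \<in> A n then a k else 0) \<longlonglongrightarrow> 0"
  proof (cases "\<exists>m. k \<in> A m")
    case True
    then obtain m where "k \<in> A m" ..
    then have "k \<notin> A n" if "n > m" for n
      using disj that \<open>k \<in> A m\<close> disjoint_family_onD[of A UNIV m n] by auto
    then show ?thesis
      by (intro tendsto_eventually eventually_mono[OF eventually_gt_at_top[of m]]) auto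
  qed simp
qed

text \<open>An index marked at step \<open>m\<close> belongs to every later
  \<open>\<Lambda> n\<close>, which the candidates of step \<open>n\<close> avoid.\<close>

lemma adaptive_run_disjoint_marked:
  assumes "adaptive_run S u \<Lambda> U C M"
  shows "disjoint_family M"
proof -
  have step: "\<Lambda> (Suc n) = \<Lambda> n \<union> M n" and new: "M n \<inter> \<Lambda> n = {}" for n
    using assms unfolding adaptive_run_def by blast+
  have "M m \<inter> M n = {}" if "m < n" for m n
  proof -
    have "\<Lambda> (Suc m) \<subseteq> \<Lambda> n"
      using step that by (intro lift_Suc_mono_le[of \<Lambda> "Suc m" n]) simp_all
    then show ?thesis
      using step[of m] new[of n] by blast
  qed
  then show ?thesis
    unfolding disjoint_family_on_def by (metis inf_commute nat_neq_iff)
qed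

text \<open>The core of the argument, detached from the algorithm: \<open>a\<close> is the limit
  estimator and \<open>\<delta>\<close> the pointwise error. Working in \<open>ennreal\<close>
  spares all summability questions.\<close>

lemma candidate_sum_tendsto_0:
  fixes \<eta> :: "nat \<Rightarrow> 'k \<Rightarrow> ennreal"
  assumes fin: "infsum a UNIV < \<infinity>"
    and disj: "disjoint_family M"
    and sub: "\<And>n. M n \<subseteq> C n"
    and upper: "\<And>n k. k \<in> C n \<Longrightarrow> \<eta> n k \<le> a k + \<delta> n k"
    and lower: "\<And>n k. k \<in> C n \<Longrightarrow> a k \<le> \<eta> n k + \<delta> n k"
    and lim: "(\<lambda>n. infsum (\<delta> n) UNIV) \<longlonglongrightarrow> 0"
    and c: "c < \<infinity>"
    and marking: "\<And>n k. k \<in> C n - M n \<Longrightarrow> \<eta> n k \<le> c * infsum (\<eta> n) (M n)"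
  shows "(\<lambda>n. infsum (\<eta> n) (C n)) \<longlonglongrightarrow> 0"
proof -
  \<comment> \<open>Used twice: for \<open>A = M n\<close> and, at the end, for
    \<open>A = C n\<close>.\<close>
  have sum_le: "infsum (\<eta> n) A \<le> infsum a A + infsum (\<delta> n) UNIV" if "A \<subseteq> C n" for n A
  proof -
    have "infsum (\<eta> n) A \<le> infsum a A + infsum (\<delta> n) A"
      unfolding infsum_ennreal_add[symmetric] using that upper by (intro infsum_ennreal_mono) auto
    also have "\<dots> \<le> infsum a A + infsum (\<delta> n) UNIV"
      by (intro add_left_mono infsum_ennreal_mono) auto
    finally show ?thesis .
  qed
  have "(\<lambda>n. infsum a (M n) + infsum (\<delta> n) UNIV) \<longlonglongrightarrow> 0"
    using tendsto_add[OF infsum_disjoint_family_tendsto_0[OF fin disj] lim] by simp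
  then have marked: "(\<lambda>n. infsum (\<eta> n) (M n)) \<longlonglongrightarrow> 0"
    by (rule ennreal_tendsto_0_le) (auto simp: sum_le sub)
  \<comment> \<open>In the factor \<open>1 + c\<close>, the 1 covers marked indices, each a term of
    the sum, and \<open>c\<close> the unmarked candidates. The last term pays for passing from
    \<open>\<eta> n\<close> to \<open>a\<close>.\<close>
  define b where "b n = (1 + c) * infsum (\<eta> n) (M n) + infsum (\<delta> n) UNIV" for n
  have b: "b \<longlonglongrightarrow> 0"
    using tendsto_add[OF tendsto_mult_ennreal[OF tendsto_const marked, of "1 + c"] lim] c
    by (simp add: b_def[abs_def])
  have "a k \<le> b n" if k: "k \<in> C n" for n k
  proof -
    have "\<eta> n k \<le> (1 + c) * infsum (\<eta> n) (M n)"
    proof (cases "k \<in> M n")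
      case True
      then show ?thesis
        using member_le_infsum_ennreal[of k "M n" "\<eta> n"] by (simp add: distrib_right add_increasing2)
    next
      case False
      then show ?thesis
        using marking[of k n] k by (simp add: distrib_right add_increasing)
    qed
    then have "\<eta> n k + \<delta> n k \<le> b n"
      unfolding b_def by (intro add_mono member_le_infsum_ennreal) auto
    then show ?thesis
      using lower[OF k] by (rule order_trans[rotated])
  qed
  then have "(\<lambda>n. if k \<in> C n then a k else 0) \<longlonglongrightarrow> 0" for k
    by (intro ennreal_tendsto_0_le[OF b]) auto
  then have "(\<lambda>n. infsum a (C n)) \<longlonglongrightarrow> 0"
    by (rule infsum_subset_tendsto_0[OF fin])
  from tendsto_add[OF this lim]
  have "(\<lambda>n. infsum a (C n) + infsum (\<delta> n) UNIV) \<longlonglongrightarrow> 0"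
    by simp
  then show ?thesis
    by (rule ennreal_tendsto_0_le) (auto simp: sum_le)
qed

text \<open>\<open>N\<close> is controlled only on \<open>V\<close>, so the difference must first be
  placed in \<open>V\<close>, as the sum of \<open>v\<close> and \<open>-1\<close> times
  \<open>w\<close>.\<close>

lemma function_norm_diff_nonneg:
  assumes "function_norm \<mu> V N" "v \<in> V" "w \<in> V"
  shows "0 \<le> N (\<lambda>x. v x - w x)"
proof -
  have add: "(\<lambda>x. f x + g x) \<in> V" if "f \<in> V" "g \<in> V" for f g
    using assms(1) that by (simp add: function_norm_def)
  have "(\<lambda>x. (- 1) *\<^sub>R w x) \<in> V"
    using assms unfolding function_norm_def by blast
  from add[OF assms(2) this] show ?thesis
    using assms(1) by (simp add: function_norm_def)
qed

theorem theorem3: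
  fixes u :: "real ^ 'm::finite \<Rightarrow> 'h::{real_inner, complete_space}"
    and S :: "(nat ^ 'm) set \<Rightarrow> (real ^ 'm \<Rightarrow> 'h) \<Rightarrow> (real ^ 'm \<Rightarrow> 'h)"
    and \<eta> :: "nat ^ 'm \<Rightarrow> (real ^ 'm \<Rightarrow> 'h) \<Rightarrow> real"
    and \<Lambda> C M :: "nat \<Rightarrow> (nat ^ 'm) set"
    and U :: "nat \<Rightarrow> (real ^ 'm \<Rightarrow> 'h)"
    and \<mu> :: "(real ^ 'm) measure"
    and V :: "(real ^ 'm \<Rightarrow> 'h) set"
    and N :: "(real ^ 'm \<Rightarrow> 'h) \<Rightarrow> real"
  assumes run: "adaptive_run S u \<Lambda> U C M"
    and eta_nonneg: "\<And>k n. 0 \<le> \<eta> k (U n)"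
    and space: "space \<mu> = param_cube"
    and norm: "function_norm \<mu> V N"
    and u_in: "u \<in> V"
    and U_in: "\<And>n. U n \<in> V"
    and reliable: "\<exists>K::ennreal. K < \<infinity> \<and>
      (\<forall>n. ennreal (N (\<lambda>x. u x - U n x)) \<le> K * total_estimator \<eta> (U n) (C n))"
    and limit: "\<exists>eta_lim :: nat ^ 'm \<Rightarrow> real.
      (\<forall>k. 0 \<le> eta_lim k) \<and> l1_norm eta_lim < \<infinity> \<and>
      (\<lambda>n. l1_norm (\<lambda>k. eta_lim k - extended_estimator \<eta> (U n) (C n \<union> \<Lambda> n) k)) \<longlonglongrightarrow> 0"
    and marking: "\<exists>c::real. c > 0 \<and>
      (\<forall>n. \<forall>k \<in> C n - M n. \<eta> k (U n) \<le> c * (\<Sum>i\<in>M n. \<eta> i (U n)))"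
  shows "(\<lambda>n. N (\<lambda>x. u x - U n x)) \<longlonglongrightarrow> 0"
proof -
  obtain K where K: "K < \<infinity>"
      "\<And>n. ennreal (N (\<lambda>x. u x - U n x)) \<le> K * total_estimator \<eta> (U n) (C n)"
    using reliable by blast
  obtain a where a: "\<And>k. 0 \<le> a k" "l1_norm a < \<infinity>"
      "(\<lambda>n. l1_norm (\<lambda>k. a k - extended_estimator \<eta> (U n) (C n \<union> \<Lambda> n) k)) \<longlonglongrightarrow> 0"
    using limit by blast
  obtain c where c: "c > 0"
      "\<And>n k. k \<in> C n - M n \<Longrightarrow> \<eta> k (U n) \<le> c * (\<Sum>i\<in>M n. \<eta> i (U n))"
    using marking by blast
  \<comment> \<open>On \<open>C n\<close> the extended estimator is \<open>\<eta> k (U n)\<close>,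
    so there both one-sided bounds are the triangle inequality.\<close>
  define \<delta> where "\<delta> n k = ennreal \<bar>a k - extended_estimator \<eta> (U n) (C n \<union> \<Lambda> n) k\<bar>" for n k
  have "(\<lambda>n. \<Sum>\<^sub>\<infinity>k\<in>C n. ennreal (\<eta> k (U n))) \<longlonglongrightarrow> 0"
  proof (rule candidate_sum_tendsto_0)
    show "(\<Sum>\<^sub>\<infinity>k. ennreal (a k)) < \<infinity>"
      using a(1,2) by (simp add: l1_norm_def)
    show "disjoint_family M"
      using run by (rule adaptive_run_disjoint_marked)
    show "M n \<subseteq> C n" for n
      using run by (simp add: adaptive_run_def)
    show "(\<lambda>n. infsum (\<delta> n) UNIV) \<longlonglongrightarrow> 0"
      using a(3) by (simp add: l1_norm_def \<delta>_def[abs_def])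
    show "ennreal c < \<infinity>"
      by simp
    fix n k
    show "ennreal (\<eta> k (U n)) \<le> ennreal (a k) + \<delta> n k" if "k \<in> C n"
      using that a(1)[of k] by (simp add: \<delta>_def extended_estimator_def flip: ennreal_plus)
    show "ennreal (a k) \<le> ennreal (\<eta> k (U n)) + \<delta> n k" if "k \<in> C n"
      using that eta_nonneg[of k n] by (simp add: \<delta>_def extended_estimator_def flip: ennreal_plus)
    show "ennreal (\<eta> k (U n)) \<le> ennreal c * (\<Sum>\<^sub>\<infinity>i\<in>M n. ennreal (\<eta> i (U n)))"
      if "k \<in> C n - M n"
    proof -
      have "finite (M n)"
        using run by (simp add: adaptive_run_def)
      then show ?thesis
        using c(1) c(2)[OF that]
        by (simp add: eta_nonneg sum_nonneg ennreal_leI flip: ennreal_mult)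
    qed
  qed
  \<comment> \<open>Finiteness of \<open>K\<close> excludes the indeterminate product of infinity
    and 0.\<close>
  from tendsto_mult_ennreal[OF tendsto_const this, of K]
  have "(\<lambda>n. K * total_estimator \<eta> (U n) (C n)) \<longlonglongrightarrow> 0"
    using K(1) by (simp add: total_estimator_def)
  then have "(\<lambda>n. ennreal (N (\<lambda>x. u x - U n x))) \<longlonglongrightarrow> ennreal 0"
    unfolding ennreal_0
    by (rule ennreal_tendsto_0_le) (auto simp: K(2))
  \<comment> \<open>\<open>ennreal\<close> sends negative reals to 0, so returning to real limits
    requires nonnegative norms.\<close>
  then show ?thesis
    by (rule tendsto_ennrealD)
      (auto intro!: always_eventually function_norm_diff_nonneg[OF norm u_in U_in])
qed

end
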